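(* Let $X$ be a Banach space over $\mathbb{K}\in\{\mathbb{R},\mathbb{C}\}$ and let $T\in B(X)$. Suppose $T$ is a strict $(m,p)$-isometry for some integer $m>1$ and some $p\in(0,\infty)$. Then there exist an integer $m_0>1$ and $p_0\in(0,\infty)$ such that, for all $\mu\in\mathbb{N}^+$ and $q\in(0,\infty)$, $T$ is a strict $(\mu,q)$-isometry if and only if $(\mu,q)=(k(m_0-1)+1,\,kp_0)$ for some $k\in\mathbb{N}^+$.
   Context: $\mathbb{N}$ denotes the natural numbers including $0$, and $\mathbb{N}^+=\mathbb{N}\setminus\{0\}$. $B(X)$ is the algebra of bounded linear operators on $X$. For $m\in\mathbb{N}^+$ and $p\in(0,\infty)$, an operator $T\in B(X)$ is an $(m,p)$-isometry if $\sum_{k=0}^{m}(-1)^k\binom{m}{k}\|T^kx\|^p=0$ for all $x\in X$. It is a strict $(m,p)$-isometry if it is an $(m,p)$-isometry and does not satisfy $\sum_{k=0}^{m-1}(-1)^k\binom{m-1}{k}\|T^kx\|^p=0$ for all $x\in X$ (for $m=1$ this last condition reads $\|x\|^p=0$ for all $x$). *)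

theory Defs
  imports "HOL-Analysis.Analysis"
begin

text \<open>
  The scalar field is a type of class \<^class>\<open>real_normed_field\<close>, whose norm is multiplicative and
  extends the absolute value of the reals. Both \<^typ>\<open>real\<close> and \<^typ>\<open>complex\<close> are instances, and by
  the Gelfand-Mazur/Ostrowski theorem every instance is isometrically isomorphic to one of these
  two. Completeness of the space comes from the class \<^class>\<open>banach\<close> of the vectors; the locale adds
  a scalar multiplication by \<open>'k\<close> that is compatible with the real one and with the norm.
\<close>

locale banach_space_over = vector_space smul
  for smul :: "'k::real_normed_field \<Rightarrow> 'x::banach \<Rightarrow> 'x" +
  assumes smul_of_real: "smul (of_real r) x = r *\<^sub>R x"
    and norm_smul: "norm (smul c x) = norm c * norm x"

definition bounded_operators ::
    "('k::real_normed_field \<Rightarrow> 'x::banach \<Rightarrow> 'x) \<Rightarrow> ('x \<Rightarrow> 'x) set"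
  where "bounded_operators smul =
    {T. Vector_Spaces.linear smul smul T \<and> (\<exists>C. \<forall>x. norm (T x) \<le> C * norm x)}"

lemma banach_space_over_real: "banach_space_over (scaleR :: real \<Rightarrow> 'x::banach \<Rightarrow> 'x)"
  by unfold_locales (auto simp: algebra_simps)

lemma banach_space_over_complex: "banach_space_over ((*) :: complex \<Rightarrow> complex \<Rightarrow> complex)"
  by unfold_locales (auto simp: algebra_simps norm_mult scaleR_conv_of_real)

lemma bounded_operators_real:
  "bounded_operators (scaleR :: real \<Rightarrow> 'x::banach \<Rightarrow> 'x) = {T. bounded_linear T}"
  by (auto simp: bounded_operators_def bounded_linear_def bounded_linear_axioms_def
      linear_def mult.commute)

definition isometry_sum :: "nat \<Rightarrow> real \<Rightarrow> ('x::real_normed_vector \<Rightarrow> 'x) \<Rightarrow> 'x \<Rightarrow> real"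
  where "isometry_sum m p T x =
    (\<Sum>k=0..m. (-1) ^ k * real (m choose k) * norm ((T ^^ k) x) powr p)"

text \<open>
  The two predicates below are meant for \<open>m \<ge> 1\<close> and \<open>p > 0\<close>. In this range
  \<^term>\<open>(0::real) powr p = 0\<close> agrees with the usual power, and \<open>m - 1\<close> is not truncated.
\<close>

definition mp_isometry :: "nat \<Rightarrow> real \<Rightarrow> ('x::real_normed_vector \<Rightarrow> 'x) \<Rightarrow> bool"
  where "mp_isometry m p T \<longleftrightarrow> (\<forall>x. isometry_sum m p T x = 0)"

definition strict_mp_isometry :: "nat \<Rightarrow> real \<Rightarrow> ('x::real_normed_vector \<Rightarrow> 'x) \<Rightarrow> bool"
  where "strict_mp_isometry m p T \<longleftrightarrow>
    mp_isometry m p T \<and> \<not> (\<forall>x. isometry_sum (m - 1) p T x = 0)"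

end

theory Submission
  imports
    Defs
    "HOL-Computational_Algebra.Field_as_Ring"
    "HOL-Computational_Algebra.Polynomial_Factorial"
begin

text \<open>
  For a vector \<open>x\<close> let \<open>f\<^sub>x n\<close> be the norm of \<open>T\<^sup>n x\<close>. Replacing \<open>x\<close> by the vectors of its orbit
  shows that \<open>T\<close> is a \<open>(d + 1, q)\<close>-isometry exactly when the differences of order \<open>d + 1\<close> of every
  sequence \<open>f\<^sub>x\<^sup>q\<close> vanish, that is, when every \<open>f\<^sub>x\<^sup>q\<close> is a polynomial in \<open>n\<close> of degree at most \<open>d\<close>
  (\<open>mp_isometry_iff_interpolated\<close>). The theorem thus concerns the
  exponents for which all these sequences become polynomial.

  If \<open>f\<^sup>p\<close> and \<open>f\<^sup>q\<close> are both polynomial, their degrees are in the ratio \<open>p : q\<close>, because both are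
  determined by the exponent of growth of \<open>f\<close> (\<open>degree_ratio\<close>). Hence the given strict
  \<open>(m, p)\<close>-isometry fixes the line \<open>(\<mu> - 1) p = (m - 1) q\<close> on which all pairs of strictness lie, and
  on that line only one question remains: for which \<open>q\<close> are all the sequences \<open>f\<^sub>x\<^sup>q\<close> polynomial
  (\<open>strict_mp_isometry_iff\<close>)?

  With \<open>s = p / (m - 1)\<close> the answer is a set \<open>A\<close> of positive integers \<open>a = q / s\<close>. Powers of
  polynomials are polynomials, so \<open>A\<close> is closed under multiples. It is also closed under greatest
  common divisors: if \<open>f\<^sup>a\<^sup>t\<close> and \<open>f\<^sup>b\<^sup>t\<close> are polynomials with \<open>a\<close>, \<open>b\<close> coprime, then by Bezout \<open>f\<^sup>t\<close> is a
  quotient of polynomials, and this quotient is a polynomial because one of its powers is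
  (\<open>interpolates_coprime_powers\<close>). A nonempty set of this kind consists of the positive multiples of
  its least element \<open>a\<^sub>0\<close>, which gives \<open>m\<^sub>0 = a\<^sub>0 + 1\<close> and \<open>p\<^sub>0 = a\<^sub>0 s\<close>.
\<close>

section \<open>Sequences with vanishing higher differences\<close>

definition alternating_difference :: "nat \<Rightarrow> (nat \<Rightarrow> real) \<Rightarrow> nat \<Rightarrow> real"
  where "alternating_difference m a n = (\<Sum>k\<le>m. (-1) ^ k * real (m choose k) * a (n + k))"

definition interpolates :: "real poly \<Rightarrow> (nat \<Rightarrow> real) \<Rightarrow> bool"
  where "interpolates P a \<longleftrightarrow> (\<forall>n. poly P (real n) = a n)"

lemma alternating_difference_0 [simp]: "alternating_difference 0 a n = a n"
  by (simp add: alternating_difference_def)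

text \<open>
  By Pascal's rule, one more order of differencing amounts to differencing the sequence itself first;
  all inductions on the order run through this equation. The sign convention is \<open>a k - a (k + 1)\<close>, so
  that no sign enters the recursion.
\<close>

lemma alternating_difference_Suc:
  "alternating_difference (Suc m) a n = alternating_difference m (\<lambda>k. a k - a (Suc k)) n"
proof -
  let ?t = "\<lambda>k. (-1) ^ k * real (m choose k) * a (n + k)"
  have "alternating_difference (Suc m) a n
      = a n + (\<Sum>k\<le>m. (-1) ^ Suc k * real (Suc m choose Suc k) * a (n + Suc k))"
    unfolding alternating_difference_def by (subst sum.atMost_Suc_shift) simp
  also have "\<dots> = (a n + (\<Sum>k\<le>m. ?t (Suc k)))
      - (\<Sum>k\<le>m. (-1) ^ k * real (m choose k) * a (n + Suc k))"
    by (simp add: algebra_simps sum.distrib sum_negf sum_subtractf)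
  also have "a n + (\<Sum>k\<le>m. ?t (Suc k)) = (\<Sum>k\<le>Suc m. ?t k)"
    by (subst sum.atMost_Suc_shift) simp
  also have "\<dots> = (\<Sum>k\<le>m. ?t k)"
    by simp
  also have "(\<Sum>k\<le>m. ?t k) - (\<Sum>k\<le>m. (-1) ^ k * real (m choose k) * a (n + Suc k))
      = alternating_difference m (\<lambda>k. a k - a (Suc k)) n"
    by (simp add: alternating_difference_def algebra_simps sum_subtractf)
  finally show ?thesis .
qed

text \<open>
  Newton's forward formula: summing \<open>n choose k\<close> over \<open>n\<close> gives \<open>n choose (k + 1)\<close>, so an expansion of the
  first differences in binomial coefficients can be summed termwise to one of the sequence.
\<close>

lemma newton_expansion:
  assumes "\<And>n. alternating_difference m a n = 0"
  shows "\<exists>c. \<forall>n. a n = (\<Sum>k<m. c k * real (n choose k))"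
  using assms
proof (induction m arbitrary: a)
  case 0
  then show ?case by simp
next
  case (Suc m)
  from Suc.IH[of "\<lambda>k. a k - a (Suc k)"] Suc.prems
  obtain c where c: "a n - a (Suc n) = (\<Sum>k<m. c k * real (n choose k))" for n
    by (auto simp: alternating_difference_Suc)
  define c' where "c' k = (case k of 0 \<Rightarrow> a 0 | Suc j \<Rightarrow> - c j)" for k
  have "a n = (\<Sum>k<Suc m. c' k * real (n choose k))" for n
  proof (induction n)
    case 0
    then show ?case
      by (subst sum.lessThan_Suc_shift) (simp add: c'_def)
  next
    case (Suc n)
    have "a (Suc n) = a n - (\<Sum>k<m. c k * real (n choose k))"
      using c[of n] by simp
    \<comment> \<open>The two sums below combine by Pascal's rule.\<close>
    also have "a n = a 0 - (\<Sum>k<m. c k * real (n choose Suc k))"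
      using Suc.IH unfolding sum.lessThan_Suc_shift by (simp add: c'_def sum_negf)
    finally show ?case
      unfolding sum.lessThan_Suc_shift
      by (simp add: c'_def algebra_simps sum.distrib sum_negf sum_subtractf)
  qed
  then show ?case by blast
qed

lemma binomial_interpolated:
  "\<exists>B :: real poly. degree B \<le> k \<and> interpolates B (\<lambda>n. real (n choose k))"
proof (induction k)
  case 0
  show ?case by (rule exI[of _ 1]) (simp add: interpolates_def)
next
  case (Suc k)
  then obtain B :: "real poly"
    where B: "degree B \<le> k" "\<And>n. poly B (real n) = real (n choose k)"
    by (auto simp: interpolates_def)
  define C where "C = smult (1 / real (Suc k)) (B * [:- real k, 1:])"
  have "degree C \<le> Suc k"
    using B(1) degree_mult_le[of B "[:- real k, 1:]"] by (simp add: C_def)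
  moreover have "poly C (real n) = real (n choose Suc k)" for n
  proof -
    have "real (Suc k) * real (n choose Suc k) = (real n - real k) * real (n choose k)"
    proof (cases "k \<le> n")
      case True
      have "Suc k * (n choose Suc k) = (n - k) * (n choose k)"
        by (simp only: binomial_absorb_comp binomial_absorption)
      then have "real (Suc k * (n choose Suc k)) = real ((n - k) * (n choose k))" by simp
      with True show ?thesis by (simp only: of_nat_mult of_nat_diff)
    next
      case False
      then show ?thesis by (simp add: not_le binomial_eq_0)
    qed
    then show ?thesis by (simp add: C_def B(2) field_simps)
  qed
  ultimately show ?case by (auto simp: interpolates_def)
qed

text \<open>
  Passing from \<open>P(x)\<close> to \<open>P(x) - P(x + 1)\<close> cancels the leading term and so lowers the degree.
\<close>

lemma alternating_difference_interpolated:
  assumes "interpolates P a" "degree P \<le> d"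
  shows "alternating_difference (Suc d) a n = 0"
  using assms
proof (induction d arbitrary: P a)
  case 0
  then obtain c where "P = [:c:]"
    by (auto elim: degree_eq_zeroE)
  with 0 have "a n = c" for n
    by (auto simp: interpolates_def)
  then show ?case by (simp add: alternating_difference_Suc)
next
  case (Suc d)
  define Q where "Q = P - pcompose P [:1, 1:]"
  have deg: "degree (pcompose P [:1, 1:]) = degree P"
    by (simp add: degree_pcompose)
  have "coeff Q (degree P) = 0"
    using lead_coeff_comp[of "[:1, 1:]" P] by (simp add: Q_def deg)
  moreover have "degree Q \<le> degree P"
    unfolding Q_def by (rule degree_diff_le) (simp_all add: deg)
  ultimately have "degree Q \<le> d"
    using Suc.prems(2) leading_coeff_0_iff[of Q] by (cases "degree Q = degree P") auto
  moreover have "interpolates Q (\<lambda>k. a k - a (Suc k))"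
    using Suc.prems(1) unfolding interpolates_def Q_def
    by (simp add: poly_pcompose flip: of_nat_Suc)
  ultimately have "alternating_difference (Suc d) (\<lambda>k. a k - a (Suc k)) n = 0"
    using Suc.IH by blast
  then show ?case by (subst alternating_difference_Suc)
qed

lemma vanishing_differences_iff_interpolated:
  "(\<forall>n. alternating_difference (Suc d) a n = 0) \<longleftrightarrow> (\<exists>P. degree P \<le> d \<and> interpolates P a)"
proof
  assume "\<forall>n. alternating_difference (Suc d) a n = 0"
  then obtain c where c: "\<And>n. a n = (\<Sum>k<Suc d. c k * real (n choose k))"
    using newton_expansion[of "Suc d" a] by auto
  obtain B :: "nat \<Rightarrow> real poly" where B: "\<And>k. degree (B k) \<le> k"
    "\<And>k. interpolates (B k) (\<lambda>n. real (n choose k))"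
    using binomial_interpolated by metis
  let ?P = "\<Sum>k<Suc d. smult (c k) (B k)"
  have "degree ?P \<le> d"
    by (rule degree_sum_le) (auto intro: order_trans[OF degree_smult_le] order_trans[OF B(1)])
  moreover have "interpolates ?P a"
    using B(2) by (simp add: interpolates_def poly_sum c)
  ultimately show "\<exists>P. degree P \<le> d \<and> interpolates P a" by blast
next
  assume "\<exists>P. degree P \<le> d \<and> interpolates P a"
  then show "\<forall>n. alternating_difference (Suc d) a n = 0"
    using alternating_difference_interpolated by blast
qed

lemma powr_of_nat_mult:
  assumes "k > 0" shows "x powr (real k * s) = (x powr s) ^ k"
  using assms by (cases "x = 0") (simp_all add: powr_power zero_power)

section \<open>Two powers of one sequence that are both polynomial\<close>

lemma interpolates_unique:
  assumes "interpolates P a" "interpolates Q a"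
  shows "P = Q"
proof (rule ccontr)
  assume "P \<noteq> Q"
  then have "finite {x. poly (P - Q) x = 0}"
    by (intro poly_roots_finite) simp
  moreover have "range real \<subseteq> {x. poly (P - Q) x = 0}"
    using assms by (auto simp: interpolates_def)
  ultimately have "finite (range real)"
    by (rule rev_finite_subset)
  then show False
    by (simp add: finite_image_iff inj_of_nat)
qed

lemma interpolates_power:
  assumes "interpolates P a" shows "interpolates (P ^ k) (\<lambda>n. a n ^ k)"
  using assms by (simp add: interpolates_def poly_power)

text \<open>
  Logarithmic growth turns the degree of a polynomial into a limit that behaves linearly when real
  powers are taken.
\<close>

lemma poly_ln_asymptotics:
  fixes P :: "real poly"
  assumes "P \<noteq> 0"
  shows "(\<lambda>n. ln \<bar>poly P (real n)\<bar> / ln (real n)) \<longlonglongrightarrow> real (degree P)"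
proof -
  let ?l = "ln \<bar>lead_coeff P\<bar>"
  have inf: "filterlim real at_infinity sequentially"
    by (rule tendsto_of_nat)
  have "(\<lambda>n. poly P (real n) / real n ^ degree P) \<longlonglongrightarrow> lead_coeff P"
    by (rule filterlim_compose[OF poly_divide_tendsto_aux inf])
  then have "(\<lambda>n. ln \<bar>poly P (real n) / real n ^ degree P\<bar>) \<longlonglongrightarrow> ?l"
    by (intro tendsto_intros) (use assms in auto)
  moreover have lnn: "filterlim (\<lambda>n. ln (real n)) at_top sequentially"
    by (rule filterlim_compose[OF ln_at_top filterlim_real_sequentially])
  ultimately have "(\<lambda>n. ln \<bar>poly P (real n) / real n ^ degree P\<bar> / ln (real n)) \<longlonglongrightarrow> 0"
    by (intro real_tendsto_divide_at_top)
  then have "(\<lambda>n. real (degree P) + ln \<bar>poly P (real n) / real n ^ degree P\<bar> / ln (real n))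
      \<longlonglongrightarrow> real (degree P) + 0"
    by (intro tendsto_intros)
  moreover have "\<forall>\<^sub>F n in sequentially.
      real (degree P) + ln \<bar>poly P (real n) / real n ^ degree P\<bar> / ln (real n)
      = ln \<bar>poly P (real n)\<bar> / ln (real n)"
  proof -
    have "\<forall>\<^sub>F n in sequentially. poly P (real n) \<noteq> 0"
      using filterlim_iff[THEN iffD1, OF inf] poly_eventually_not_zero[OF assms] by blast
    with eventually_gt_at_top[of 1] show ?thesis
      by eventually_elim (simp add: abs_divide power_abs ln_div ln_realpow field_simps)
  qed
  ultimately show ?thesis
    by (simp add: filterlim_cong[OF refl refl])
qed

text \<open>
  Both \<open>deg P / p\<close> and \<open>deg Q / q\<close> are the limit of \<open>ln |f(n)| / ln n\<close>. The zero sequence has no such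
  limit, but then both polynomials vanish and have degree \<open>0\<close>.
\<close>

lemma degree_ratio:
  fixes f :: "nat \<Rightarrow> real"
  assumes "p > 0" "q > 0"
    and P: "interpolates P (\<lambda>n. f n powr p)" and Q: "interpolates Q (\<lambda>n. f n powr q)"
  shows "q * real (degree P) = p * real (degree Q)"
proof -
  have P': "poly P (real n) = f n powr p" and Q': "poly Q (real n) = f n powr q" for n
    using P Q by (auto simp: interpolates_def)
  have zero: "P = 0 \<longleftrightarrow> (\<forall>n. f n = 0)" "Q = 0 \<longleftrightarrow> (\<forall>n. f n = 0)"
  proof -
    have "P = 0 \<longleftrightarrow> (\<forall>n. f n powr p = 0)" "Q = 0 \<longleftrightarrow> (\<forall>n. f n powr q = 0)"
      using interpolates_unique[OF P, of 0] interpolates_unique[OF Q, of 0] P' Q'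
      by (auto simp: interpolates_def)
    then show "P = 0 \<longleftrightarrow> (\<forall>n. f n = 0)" "Q = 0 \<longleftrightarrow> (\<forall>n. f n = 0)"
      by simp_all
  qed
  show ?thesis
  proof (cases "P = 0")
    case True
    with zero have "Q = 0" by blast
    with True show ?thesis by simp
  next
    case False
    with zero have "Q \<noteq> 0" by blast
    have "(\<lambda>n. q * (ln \<bar>poly P (real n)\<bar> / ln (real n))) \<longlonglongrightarrow> q * real (degree P)"
      by (intro tendsto_intros poly_ln_asymptotics False)
    moreover have "(\<lambda>n. p * (ln \<bar>poly Q (real n)\<bar> / ln (real n))) \<longlonglongrightarrow> p * real (degree Q)"
      by (intro tendsto_intros poly_ln_asymptotics \<open>Q \<noteq> 0\<close>)
    moreover have "q * (ln \<bar>poly P (real n)\<bar> / ln (real n))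
        = p * (ln \<bar>poly Q (real n)\<bar> / ln (real n))" for n
      by (cases "f n = 0") (simp_all add: P' Q' ln_powr)
    ultimately show ?thesis
      by (simp only: LIMSEQ_unique)
  qed
qed

text \<open>
  If \<open>g = f\<^sup>s\<close> has coprime powers \<open>g\<^sup>a = Q\<close> and \<open>g\<^sup>b = P\<close>, Bezout coefficients \<open>a u = b v + 1\<close> suggest
  \<open>g = Q\<^sup>u / P\<^sup>v\<close>. That this quotient is a polynomial follows by comparing \<open>b\<close>-th powers: \<open>P\<^sup>v\<^sup>b\<close> divides
  \<open>Q\<^sup>u\<^sup>b\<close>, and in a ring with greatest common divisors the exponent \<open>b\<close> can be cancelled. Defining \<open>R\<close>
  as this quotient rather than as a \<open>b\<close>-th root of \<open>P\<close> also settles its sign: at every \<open>n\<close> the value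
  is \<open>g(n)\<close> itself.
\<close>

lemma interpolates_coprime_powers:
  fixes f :: "nat \<Rightarrow> real"
  assumes "coprime a b" "a > 0" "b > 0"
    and Q: "interpolates Q (\<lambda>n. f n powr (real a * s))"
    and P: "interpolates P (\<lambda>n. f n powr (real b * s))"
  shows "\<exists>R. interpolates R (\<lambda>n. f n powr s)"
proof (cases "P = 0")
  case True
  have "f n powr (real b * s) = 0" for n
    using P True by (auto simp: interpolates_def)
  then have "f n = 0" for n
    by simp
  then show ?thesis
    by (intro exI[of _ 0]) (simp add: interpolates_def)
next
  case False
  have Q': "poly Q (real n) = (f n powr s) ^ a" and P': "poly P (real n) = (f n powr s) ^ b" for n
    using Q P \<open>a > 0\<close> \<open>b > 0\<close> by (simp_all add: interpolates_def powr_of_nat_mult)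
  obtain u v where uv: "a * u = b * v + 1"
    using bezout_nat[of a b] assms by auto
  have "P ^ a = Q ^ b"
    by (rule interpolates_unique[of _ "\<lambda>n. (f n powr s) ^ (a * b)"])
      (simp_all add: interpolates_def poly_power P' Q' mult.commute flip: power_mult)
  have Qub: "(Q ^ u) ^ b = (P ^ v) ^ b * P"
  proof -
    have "(Q ^ u) ^ b = (Q ^ b) ^ u" by (simp add: mult.commute flip: power_mult)
    also have "\<dots> = P ^ (b * v + 1)" by (simp add: uv flip: power_mult \<open>P ^ a = Q ^ b\<close>)
    also have "\<dots> = (P ^ v) ^ b * P" by (simp add: mult.commute flip: power_mult)
    finally show ?thesis .
  qed
  then have "(P ^ v) ^ b dvd (Q ^ u) ^ b"
    by simp
  then have "P ^ v dvd Q ^ u"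
    using \<open>b > 0\<close> by (subst (asm) pow_divides_pow_iff) auto
  then obtain R where R: "Q ^ u = P ^ v * R" by auto
  have "R ^ b = P"
    using Qub False by (simp add: R power_mult_distrib)
  have "poly R (real n) = f n powr s" for n
  proof (cases "f n = 0")
    \<comment> \<open>At a zero of \<open>P\<close> the quotient gives no information about \<open>R\<close>, but \<open>R\<^sup>b = P\<close> does.\<close>
    case True
    then have "poly R (real n) ^ b = 0"
      using P'[of n] \<open>b > 0\<close> by (simp flip: \<open>R ^ b = P\<close> poly_power)
    with True show ?thesis by simp
  next
    case False
    let ?g = "f n powr s"
    have "?g \<noteq> 0" using False by simp
    have "?g ^ (b * v) * poly R (real n) = ?g ^ (b * v) * ?g"
      using arg_cong[OF R, of "\<lambda>p. poly p (real n)"]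
      by (auto simp: poly_power P' Q' uv simp flip: power_mult)
    with \<open>?g \<noteq> 0\<close> show ?thesis by (metis mult_left_cancel power_not_zero)
  qed
  then show ?thesis by (auto simp: interpolates_def)
qed

section \<open>Orbits of an operator\<close>

definition orbit_power :: "('x::real_normed_vector \<Rightarrow> 'x) \<Rightarrow> real \<Rightarrow> 'x \<Rightarrow> nat \<Rightarrow> real"
  where "orbit_power T q x n = norm ((T ^^ n) x) powr q"

definition polynomial_orbits :: "('x::real_normed_vector \<Rightarrow> 'x) \<Rightarrow> real \<Rightarrow> bool"
  where "polynomial_orbits T q \<longleftrightarrow> (\<forall>x. \<exists>P. interpolates P (orbit_power T q x))"

lemma isometry_sum_orbit:
  "isometry_sum m q T ((T ^^ n) x) = alternating_difference m (orbit_power T q x) n"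
  by (simp add: isometry_sum_def alternating_difference_def orbit_power_def atLeast0AtMost
      add.commute[of n] funpow_add)

text \<open>
  The defining identity concerns only the difference at the start of each orbit; since it holds for
  all vectors, it applies to \<open>T\<^sup>n x\<close> and gives the differences at every \<open>n\<close>.
\<close>

lemma mp_isometry_iff_interpolated:
  "mp_isometry (Suc d) q T \<longleftrightarrow> (\<forall>x. \<exists>P. degree P \<le> d \<and> interpolates P (orbit_power T q x))"
proof -
  have "mp_isometry (Suc d) q T \<longleftrightarrow> (\<forall>x n. isometry_sum (Suc d) q T ((T ^^ n) x) = 0)"
    unfolding mp_isometry_def by (metis funpow_0)
  then show ?thesis
    by (simp add: isometry_sum_orbit vanishing_differences_iff_interpolated)
qed

text \<open>
  Strictness means that the maximal degree over all orbits is attained: it is \<open>d + 1\<close> for the exponent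
  \<open>p\<close>, at some \<open>x\<^sub>0\<close>. For any other exponent \<open>q\<close> with polynomial orbits all degrees are rescaled by
  \<open>q / p\<close>, so their maximum \<open>(d + 1) q / p\<close> is attained at the same \<open>x\<^sub>0\<close> and must be \<open>e\<close>.
\<close>

lemma strict_mp_isometry_iff:
  fixes T :: "'x::real_normed_vector \<Rightarrow> 'x"
  assumes "p > 0" and strict: "strict_mp_isometry (Suc (Suc d)) p T"
    and "q > 0"
  shows "strict_mp_isometry (Suc e) q T \<longleftrightarrow>
    polynomial_orbits T q \<and> real e * p = real (Suc d) * q"
proof -
  obtain P where P: "\<And>x. degree (P x) \<le> Suc d" "\<And>x. interpolates (P x) (orbit_power T p x)"
    using strict unfolding strict_mp_isometry_def mp_isometry_iff_interpolated by metis
  obtain x\<^sub>0 where x0: "degree (P x\<^sub>0) = Suc d"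
    using strict P mp_isometry_iff_interpolated[of d p T] unfolding strict_mp_isometry_def
    by (metis diff_Suc_1 le_SucE mp_isometry_def)
  have ratio: "q * real (degree (P x)) = p * real (degree Q)"
    if "interpolates Q (orbit_power T q x)" for Q x
    using degree_ratio[of p q "P x" "\<lambda>n. norm ((T ^^ n) x)" Q] that P(2)[of x] assms
    by (simp add: orbit_power_def[abs_def])
  show ?thesis
  proof (intro iffI conjI)
    assume L: "strict_mp_isometry (Suc e) q T"
    then have iso: "mp_isometry (Suc e) q T"
      by (simp add: strict_mp_isometry_def)
    then show "polynomial_orbits T q"
      unfolding mp_isometry_iff_interpolated polynomial_orbits_def by blast
    obtain Q where Q: "\<And>x. degree (Q x) \<le> e" "\<And>x. interpolates (Q x) (orbit_power T q x)"
      using iso unfolding mp_isometry_iff_interpolated by metis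
    have "degree (Q x\<^sub>0) = e"
    proof (rule ccontr)
      assume "degree (Q x\<^sub>0) \<noteq> e"
      with Q(1)[of x\<^sub>0] obtain e' where e': "e = Suc e'" "degree (Q x\<^sub>0) \<le> e'"
        by (cases e) auto
      have "degree (Q x) \<le> e'" for x
      proof -
        have "p * real (degree (Q x)) = q * real (degree (P x))"
          using ratio[OF Q(2)[of x]] by simp
        also have "\<dots> \<le> q * real (degree (P x\<^sub>0))"
          using P(1)[of x] x0 \<open>q > 0\<close> by simp
        also have "\<dots> = p * real (degree (Q x\<^sub>0))"
          by (rule ratio[OF Q(2)])
        finally show ?thesis using \<open>p > 0\<close> e' by simp
      qed
      with Q(2) have "mp_isometry e q T"
        unfolding e' mp_isometry_iff_interpolated by blast
      with L show False
        by (simp add: strict_mp_isometry_def mp_isometry_def)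
    qed
    with ratio[OF Q(2)[of x\<^sub>0]] x0 show "real e * p = real (Suc d) * q"
      by (simp add: mult.commute)
  next
    assume R: "polynomial_orbits T q \<and> real e * p = real (Suc d) * q"
    \<comment> \<open>This excludes the case \<open>e = 0\<close>, in which strictness is not about degrees but about \<open>X \<noteq> 0\<close>.\<close>
    then have "e > 0"
      using assms by (auto intro!: Nat.gr0I)
    then obtain e' where e': "e = Suc e'" by (cases e) auto
    have scale: "p * real e = q * real (Suc d)"
      using R by (simp add: mult.commute)
    obtain Q where Q: "\<And>x. interpolates (Q x) (orbit_power T q x)"
      using R unfolding polynomial_orbits_def by metis
    have "degree (Q x) \<le> e" for x
    proof -
      have "p * real (degree (Q x)) = q * real (degree (P x))"
        using ratio[OF Q[of x]] by simp
      also have "\<dots> \<le> q * real (Suc d)"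
        using P(1)[of x] \<open>q > 0\<close> by (intro mult_left_mono) simp_all
      finally show ?thesis unfolding scale[symmetric] using \<open>p > 0\<close> by simp
    qed
    with Q have "mp_isometry (Suc e) q T"
      unfolding mp_isometry_iff_interpolated by blast
    moreover have "\<not> mp_isometry e q T"
    proof
      assume "mp_isometry e q T"
      then obtain Q' where Q': "degree Q' \<le> e'" "interpolates Q' (orbit_power T q x\<^sub>0)"
        unfolding e' mp_isometry_iff_interpolated by metis
      have "p * real (degree Q') = p * real e"
        using ratio[OF Q'(2)] x0 scale by auto
      with Q'(1) \<open>p > 0\<close> e' show False by simp
    qed
    ultimately show "strict_mp_isometry (Suc e) q T"
      by (simp add: strict_mp_isometry_def mp_isometry_def)
  qed
qed

lemma polynomial_orbits_multiple:
  assumes "polynomial_orbits T q" "k > 0"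
  shows "polynomial_orbits T (real k * q)"
  unfolding polynomial_orbits_def
proof
  fix x
  obtain P where P: "interpolates P (orbit_power T q x)"
    using assms unfolding polynomial_orbits_def by blast
  have "orbit_power T q x n ^ k = orbit_power T (real k * q) x n" for n
    using \<open>k > 0\<close> by (simp add: orbit_power_def powr_of_nat_mult)
  then show "\<exists>P. interpolates P (orbit_power T (real k * q) x)"
    using interpolates_power[OF P, of k] by auto
qed

lemma polynomial_orbits_gcd:
  assumes "polynomial_orbits T (real a * s)" "polynomial_orbits T (real b * s)"
    and "a > 0" "b > 0"
  shows "polynomial_orbits T (real (gcd a b) * s)"
  unfolding polynomial_orbits_def
proof
  fix x
  obtain a' b' where ab: "a = a' * gcd a b" "b = b' * gcd a b" "coprime a' b'"
    using gcd_coprime_exists[of a b] \<open>a > 0\<close> by auto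
  have "a' > 0" "b' > 0"
    using ab \<open>a > 0\<close> \<open>b > 0\<close> by (metis gr0I mult_0)+
  have eqs: "real a * s = real a' * (real (gcd a b) * s)" "real b * s = real b' * (real (gcd a b) * s)"
    by (metis ab(1) mult.assoc of_nat_mult, metis ab(2) mult.assoc of_nat_mult)
  obtain P Q where "interpolates Q (orbit_power T (real a * s) x)"
    "interpolates P (orbit_power T (real b * s) x)"
    using assms(1,2) unfolding polynomial_orbits_def by blast
  then show "\<exists>R. interpolates R (orbit_power T (real (gcd a b) * s) x)"
    using interpolates_coprime_powers[of a' b' Q "\<lambda>n. norm ((T ^^ n) x)" "real (gcd a b) * s" P]
      ab(3) \<open>a' > 0\<close> \<open>b' > 0\<close>
    by (simp add: orbit_power_def[abs_def] eqs)
qed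

lemma gcd_closed_eq_multiples:
  fixes A :: "nat set"
  assumes "c \<in> A" "0 \<notin> A"
    and gcd: "\<And>a b. a \<in> A \<Longrightarrow> b \<in> A \<Longrightarrow> gcd a b \<in> A"
    and mult: "\<And>a k. a \<in> A \<Longrightarrow> k > 0 \<Longrightarrow> k * a \<in> A"
  shows "\<exists>a\<^sub>0>0. \<forall>a. a \<in> A \<longleftrightarrow> (\<exists>k>0. a = k * a\<^sub>0)"
proof -
  define a\<^sub>0 where "a\<^sub>0 = (LEAST a. a \<in> A)"
  have "a\<^sub>0 \<in> A" unfolding a\<^sub>0_def using \<open>c \<in> A\<close> by (rule LeastI)
  then have "a\<^sub>0 > 0" using \<open>0 \<notin> A\<close> by (cases a\<^sub>0) auto
  have "\<exists>k>0. a = k * a\<^sub>0" if "a \<in> A" for a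
  proof -
    have "a\<^sub>0 \<le> gcd a a\<^sub>0"
      unfolding a\<^sub>0_def[symmetric] using gcd[OF that \<open>a\<^sub>0 \<in> A\<close>] by (subst a\<^sub>0_def) (rule Least_le)
    then have "gcd a a\<^sub>0 = a\<^sub>0"
      using gcd_le2_nat[of a\<^sub>0 a] \<open>a\<^sub>0 > 0\<close> by linarith
    then have "a\<^sub>0 dvd a" by (metis gcd_dvd1)
    moreover have "a \<noteq> 0" using that \<open>0 \<notin> A\<close> by metis
    ultimately show ?thesis by (auto elim!: dvdE simp: mult.commute)
  qed
  with \<open>a\<^sub>0 \<in> A\<close> \<open>a\<^sub>0 > 0\<close> mult show ?thesis by blast
qed

theorem theorem4p9:
  fixes smul :: "'k::real_normed_field \<Rightarrow> 'x::banach \<Rightarrow> 'x"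
    and T :: "'x \<Rightarrow> 'x"
    and m :: nat and p :: real
  assumes "banach_space_over smul"
    and "T \<in> bounded_operators smul"
    and "m > 1" and "p > 0"
    and "strict_mp_isometry m p T"
  shows "\<exists>(m\<^sub>0::nat) (p\<^sub>0::real). m\<^sub>0 > 1 \<and> p\<^sub>0 > 0 \<and>
    (\<forall>(\<mu>::nat) (q::real). \<mu> > 0 \<longrightarrow> q > 0 \<longrightarrow>
      (strict_mp_isometry \<mu> q T \<longleftrightarrow>
        (\<exists>k::nat. k > 0 \<and> (\<mu>, q) = (k * (m\<^sub>0 - 1) + 1, real k * p\<^sub>0))))"
proof -
  obtain d where m: "m = Suc (Suc d)"
    using \<open>m > 1\<close> by (cases m rule: nat.exhaust; cases "m - 1") auto
  \<comment> \<open>On the line of admissible pairs, increasing \<open>\<mu>\<close> by one increases the exponent by \<open>s\<close>.\<close>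
  define s where "s = p / real (Suc d)"
  have "s > 0" using \<open>p > 0\<close> by (simp add: s_def)
  have strict_iff: "strict_mp_isometry (Suc e) q T \<longleftrightarrow>
      polynomial_orbits T (real e * s) \<and> q = real e * s" if "q > 0" for e q
  proof -
    have "real e * p = real (Suc d) * q \<longleftrightarrow> q = real e * s"
      unfolding s_def by (simp add: field_simps) auto
    then show ?thesis
      using strict_mp_isometry_iff[of p d T q e] assms(4,5) that unfolding m by auto
  qed
  define A where "A = {a. a > 0 \<and> polynomial_orbits T (real a * s)}"
  have "Suc d \<in> A"
    using strict_iff[of p "Suc d"] assms(4,5) by (simp add: A_def m)
  moreover have "k * a \<in> A" if "a \<in> A" "k > 0" for a k
    using that polynomial_orbits_multiple[of T "real a * s" k] by (simp add: A_def mult.assoc)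
  moreover have "gcd a b \<in> A" if "a \<in> A" "b \<in> A" for a b
    using that polynomial_orbits_gcd[of T a s b] by (simp add: A_def)
  moreover have "0 \<notin> A" by (simp add: A_def)
  ultimately obtain a\<^sub>0 where a0: "a\<^sub>0 > 0" "\<And>a. a \<in> A \<longleftrightarrow> (\<exists>k>0. a = k * a\<^sub>0)"
    using gcd_closed_eq_multiples[of "Suc d" A] by blast
  have "strict_mp_isometry \<mu> q T \<longleftrightarrow>
      (\<exists>k::nat. k > 0 \<and> (\<mu>, q) = (k * (Suc a\<^sub>0 - 1) + 1, real k * (real a\<^sub>0 * s)))"
    if "\<mu> > 0" "q > 0" for \<mu> q
  proof -
    obtain e where e: "\<mu> = Suc e" using \<open>\<mu> > 0\<close> by (cases \<mu>) auto
    have "strict_mp_isometry \<mu> q T \<longleftrightarrow> e \<in> A \<and> q = real e * s"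
      unfolding e strict_iff[OF \<open>q > 0\<close>] A_def using \<open>q > 0\<close> by (auto intro!: Nat.gr0I)
    also have "\<dots> \<longleftrightarrow> (\<exists>k::nat. k > 0 \<and> (\<mu>, q) = (k * (Suc a\<^sub>0 - 1) + 1, real k * (real a\<^sub>0 * s)))"
      unfolding a0(2) e by auto
    finally show ?thesis .
  qed
  with a0(1) \<open>s > 0\<close> show ?thesis
    by (intro exI[of _ "Suc a\<^sub>0"] exI[of _ "real a\<^sub>0 * s"]) auto
qed

end
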